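(* Let $\mathcal{H}$ be a complex separable Hilbert space and let $(T,V)$ be a pair of doubly twisted operators on $\mathcal{H}$ such that $T$ is a contraction. Let $\mathcal{H}=\mathcal{H}_u\oplus\mathcal{H}_{\neg u}$ be the canonical decomposition for the contraction $T$. Then this decomposition reduces the operator $V$; that is, $\mathcal{H}_u$ and $\mathcal{H}_{\neg u}$ are reducing subspaces for $V$.
   Context: Operators are bounded linear operators on a complex separable Hilbert space. A pair $(T_1,T_2)$ of operators on $\mathcal{H}$ is called doubly twisted if there is a unitary operator $U$ on $\mathcal{H}$ (a twist) such that $T_1T_2=UT_2T_1$, $T_1^*T_2=U^*T_2T_1^*$, and $T_iU=UT_i$ for $i=1,2$. A contraction is an operator $T$ with $\|Th\|\le\|h\|$ for all $h$. A closed subspace $\mathcal{M}$ reduces $T$ if $T\mathcal{M}\subseteq\mathcal{M}$ and $T\mathcal{M}^\perp\subseteq\mathcal{M}^\perp$. A contraction is completely non-unitary (c.n.u.) if it has no nonzero reducing subspace on which it is unitary. The canonical decomposition for a contraction $T$ on $\mathcal{H}$ is the unique orthogonal decomposition $\mathcal{H}=\mathcal{H}_u\oplus\mathcal{H}_{\neg u}$ into $T$-reducing subspaces (possibly $\{0\}$) such that $T|_{\mathcal{H}_u}$ is unitary and $T|_{\mathcal{H}_{\neg u}}$ is c.n.u.; explicitly $\mathcal{H}_u=\{h\in\mathcal{H}:\|T^nh\|=\|h\|=\|T^{*n}h\|,\ n=1,2,\dots\}$. *)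

theory Defs
  imports "HOL-Analysis.Analysis"
begin

text \<open>
  A complex inner product space is a real inner product space (whence norm and topology) with a
  compatible complex structure; \<open>cinner\<close> is linear in its first argument and its real part is
  the given real inner product, so that \<open>norm x ^ 2 = cinner x x\<close>.
\<close>

class complex_inner = real_inner +
  fixes scaleC :: "complex \<Rightarrow> 'a \<Rightarrow> 'a"  (infixr \<open>*\<^sub>C\<close> 75)
    and cinner :: "'a \<Rightarrow> 'a \<Rightarrow> complex"
  assumes scaleC_add_right: "a *\<^sub>C (x + y) = a *\<^sub>C x + a *\<^sub>C y"
    and scaleC_add_left: "(a + b) *\<^sub>C x = a *\<^sub>C x + b *\<^sub>C x"
    and scaleC_scaleC: "a *\<^sub>C b *\<^sub>C x = (a * b) *\<^sub>C x"
    and scaleR_scaleC: "r *\<^sub>R x = complex_of_real r *\<^sub>C x"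
    and cinner_commute: "cinner x y = cnj (cinner y x)"
    and cinner_add_left: "cinner (x + y) z = cinner x z + cinner y z"
    and cinner_scaleC_left: "cinner (a *\<^sub>C x) y = a * cinner x y"
    and inner_eq_Re_cinner: "inner x y = Re (cinner x y)"

class complex_hilbert_space = complex_inner + complete_space

global_interpretation complex_vector:
  vector_space "scaleC :: complex \<Rightarrow> 'a::complex_inner \<Rightarrow> 'a"
proof
  show "(1::complex) *\<^sub>C x = x" for x :: 'a
    using scaleR_scaleC[of 1 x] by simp
qed (simp_all add: scaleC_add_right scaleC_add_left scaleC_scaleC)

lemma cinner_self: "cinner x x = complex_of_real ((norm x)\<^sup>2)"
proof (rule complex_eqI)
  show "Re (cinner x x) = Re (complex_of_real ((norm x)\<^sup>2))"
    by (simp flip: inner_eq_Re_cinner add: power2_norm_eq_inner)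
  have "Im (cinner x x) = - Im (cinner x x)"
    using arg_cong[OF cinner_commute[of x x], of Im] by simp
  then show "Im (cinner x x) = Im (complex_of_real ((norm x)\<^sup>2))" by simp
qed

instantiation complex :: complex_hilbert_space
begin

definition scaleC_complex :: "complex \<Rightarrow> complex \<Rightarrow> complex" where
  "scaleC_complex a x = a * x"

definition cinner_complex :: "complex \<Rightarrow> complex \<Rightarrow> complex" where
  "cinner_complex x y = x * cnj y"

instance
  by standard
    (simp_all add: scaleC_complex_def cinner_complex_def algebra_simps scaleR_conv_of_real
      inner_complex_def)

end

definition bounded_clinear :: "('a::complex_inner \<Rightarrow> 'b::complex_inner) \<Rightarrow> bool" where
  "bounded_clinear T \<longleftrightarrow> Vector_Spaces.linear scaleC scaleC T \<and> (\<exists>K. \<forall>x. norm (T x) \<le> norm x * K)"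

text \<open>
  The Hilbert space adjoint. It is unique when it exists, and for bounded operators on a
  Hilbert space it exists by the Riesz representation theorem.
\<close>

definition cadjoint :: "('a::complex_inner \<Rightarrow> 'b::complex_inner) \<Rightarrow> 'b \<Rightarrow> 'a" where
  "cadjoint T = (SOME S. \<forall>x y. cinner (T x) y = cinner x (S y))"

definition contraction :: "('a::complex_inner \<Rightarrow> 'a) \<Rightarrow> bool" where
  "contraction T \<longleftrightarrow> bounded_clinear T \<and> (\<forall>h. norm (T h) \<le> norm h)"

definition closed_csubspace :: "'a::complex_inner set \<Rightarrow> bool" where
  "closed_csubspace M \<longleftrightarrow> complex_vector.subspace M \<and> closed M"

definition corthogonal_comp :: "'a::complex_inner set \<Rightarrow> 'a set" where
  "corthogonal_comp M = {y. \<forall>x\<in>M. cinner x y = 0}"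

text \<open>
  Restrictions: below, \<open>K\<close> is a closed subspace invariant under \<open>T\<close>, and the predicates express
  properties of the operator \<open>T|K\<close> on the Hilbert space \<open>K\<close>. Accordingly, the orthogonal
  complement of \<open>M \<subseteq> K\<close> is taken inside \<open>K\<close>. The operator \<open>T\<close> itself is the case \<open>K = UNIV\<close>.
\<close>

definition unitary_on :: "'a::complex_inner set \<Rightarrow> ('a \<Rightarrow> 'a) \<Rightarrow> bool" where
  "unitary_on K T \<longleftrightarrow> T ` K = K \<and> (\<forall>x\<in>K. \<forall>y\<in>K. cinner (T x) (T y) = cinner x y)"

definition reduces_on :: "'a::complex_inner set \<Rightarrow> ('a \<Rightarrow> 'a) \<Rightarrow> 'a set \<Rightarrow> bool" where
  "reduces_on K T M \<longleftrightarrow> closed_csubspace M \<and> M \<subseteq> K \<and> T ` M \<subseteq> M \<and>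
     T ` (K \<inter> corthogonal_comp M) \<subseteq> K \<inter> corthogonal_comp M"

definition cnu_on :: "'a::complex_inner set \<Rightarrow> ('a \<Rightarrow> 'a) \<Rightarrow> bool" where
  "cnu_on K T \<longleftrightarrow> \<not> (\<exists>M. reduces_on K T M \<and> M \<noteq> {0} \<and> unitary_on M T)"

abbreviation reduces :: "('a::complex_inner \<Rightarrow> 'a) \<Rightarrow> 'a set \<Rightarrow> bool" where
  "reduces T M \<equiv> reduces_on UNIV T M"

definition unitary :: "('a::complex_inner \<Rightarrow> 'a) \<Rightarrow> bool" where
  "unitary U \<longleftrightarrow> bounded_clinear U \<and> unitary_on UNIV U"

definition is_twist :: "('a::complex_inner \<Rightarrow> 'a) \<Rightarrow> ('a \<Rightarrow> 'a) \<Rightarrow> ('a \<Rightarrow> 'a) \<Rightarrow> bool" where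
  "is_twist U T\<^sub>1 T\<^sub>2 \<longleftrightarrow> unitary U \<and>
     T\<^sub>1 \<circ> T\<^sub>2 = U \<circ> T\<^sub>2 \<circ> T\<^sub>1 \<and>
     cadjoint T\<^sub>1 \<circ> T\<^sub>2 = cadjoint U \<circ> T\<^sub>2 \<circ> cadjoint T\<^sub>1 \<and>
     T\<^sub>1 \<circ> U = U \<circ> T\<^sub>1 \<and> T\<^sub>2 \<circ> U = U \<circ> T\<^sub>2"

definition doubly_twisted :: "('a::complex_inner \<Rightarrow> 'a) \<Rightarrow> ('a \<Rightarrow> 'a) \<Rightarrow> bool" where
  "doubly_twisted T\<^sub>1 T\<^sub>2 \<longleftrightarrow> bounded_clinear T\<^sub>1 \<and> bounded_clinear T\<^sub>2 \<and> (\<exists>U. is_twist U T\<^sub>1 T\<^sub>2)"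

definition orthogonal_decomposition :: "'a::complex_inner set \<Rightarrow> 'a set \<Rightarrow> bool" where
  "orthogonal_decomposition M N \<longleftrightarrow> closed_csubspace M \<and> closed_csubspace N \<and>
     (\<forall>x\<in>M. \<forall>y\<in>N. cinner x y = 0) \<and> (\<forall>h. \<exists>x\<in>M. \<exists>y\<in>N. h = x + y)"

text \<open>
  Every contraction on a Hilbert space has exactly one such decomposition (Sz.-Nagy--Foias, Langer).
\<close>

definition canonical_decomposition ::
  "('a::complex_inner \<Rightarrow> 'a) \<Rightarrow> 'a set \<Rightarrow> 'a set \<Rightarrow> bool" where
  "canonical_decomposition T H\<^sub>u H\<^sub>n \<longleftrightarrow> orthogonal_decomposition H\<^sub>u H\<^sub>n \<and>
     reduces T H\<^sub>u \<and> reduces T H\<^sub>n \<and> unitary_on H\<^sub>u T \<and> cnu_on H\<^sub>n T"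

end

theory Submission
  imports Defs
begin

text \<open>
  Call a set \<open>S\<close> inverse-stable for \<open>T\<close> if it is invariant under \<open>T\<close> and \<open>T\<^sup>*\<close> and these two maps
  are mutually inverse on it. Inverse-stability survives unions, sums, scalar multiples and
  closures, so the union \<open>K\<close> of all inverse-stable sets is a closed subspace, reduces \<open>T\<close>, and \<open>T\<close>
  is unitary on it. The subspace \<open>H\<^sub>u\<close> is inverse-stable, hence \<open>H\<^sub>u \<subseteq> K\<close>; and \<open>K \<inter> H\<^sub>n\<close> is a
  reducing subspace of the completely non-unitary part on which \<open>T\<close> is unitary, hence zero. So
  \<open>H\<^sub>u = K\<close>.

  Since \<open>K\<close> is a maximal set defined by \<open>T\<close> and \<open>T\<^sup>*\<close> alone, an operator maps \<open>K\<close> into itself as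
  soon as the image of \<open>K\<close> lies in some inverse-stable set. From \<open>T V = U V T\<close> and
  \<open>T\<^sup>* V = U\<^sup>* V T\<^sup>*\<close> the set \<open>V K\<close> is carried by \<open>T\<close> and
  \<open>T\<^sup>*\<close> into its translates by \<open>U\<close> and \<open>U\<^sup>*\<close>, which commute with \<open>T\<close> and \<open>T\<^sup>*\<close>. The union of all
  translates of \<open>V K\<close> by maps commuting with \<open>T\<close> and \<open>T\<^sup>*\<close> is therefore inverse-stable, because
  the factors \<open>U\<close> and \<open>U\<^sup>*\<close> cancel in \<open>T\<^sup>* T\<close> and \<open>T T\<^sup>*\<close>; by maximality \<open>V K \<subseteq> K\<close>. Taking adjoints,
  \<open>(T, V\<^sup>*)\<close> satisfies the same relations with \<open>U\<close> and \<open>U\<^sup>*\<close> exchanged, so \<open>V\<^sup>* K \<subseteq> K\<close> as well, and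
  \<open>K\<close> reduces \<open>V\<close>. Adjoints exist by the Riesz representation theorem, which is proved here by
  minimising \<open>\<parallel>x\<parallel>\<^sup>2 - 2 f x\<close>.
\<close>

section \<open>Riesz representation and adjoints\<close>

text \<open>
  A minimiser of \<open>\<parallel>x\<parallel>\<^sup>2 - 2 f x\<close> represents \<open>f\<close>, since the first variation vanishes there. It exists
  because the parallelogram law makes every minimising sequence Cauchy.
\<close>

lemma riesz_representation_real:
  fixes f :: "'a::{real_inner,complete_space} \<Rightarrow> real"
  assumes "bounded_linear f"
  shows "\<exists>z. \<forall>x. f x = inner x z"
proof -
  interpret f: bounded_linear f by fact
  obtain K where K: "\<And>x. norm (f x) \<le> norm x * K" using f.bounded by blast
  define \<phi> where "\<phi> x = (norm x)\<^sup>2 - 2 * f x" for x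
  have lower: "- (K\<^sup>2) \<le> \<phi> x" for x
  proof -
    have "f x \<le> norm x * K" using K[of x] by simp
    moreover have "0 \<le> (norm x - K)\<^sup>2" by simp
    ultimately show ?thesis unfolding \<phi>_def power2_diff by simp
  qed
  define m where "m = (INF x. \<phi> x)"
  have bdd: "bdd_below (range \<phi>)" using lower by (rule bdd_belowI2)
  have m: "m \<le> \<phi> x" for x unfolding m_def by (rule cINF_lower[OF bdd]) simp
  have "\<exists>x. \<phi> x < m + 1 / Suc n" for n
  proof -
    have "Inf (range \<phi>) < m + 1 / Suc n" by (simp add: m_def)
    then show ?thesis using cInf_lessD[of "range \<phi>"] by blast
  qed
  then obtain X where X: "\<And>n. \<phi> (X n) < m + 1 / Suc n" by metis
  have par: "(dist x y)\<^sup>2 = 2 * \<phi> x + 2 * \<phi> y - 4 * \<phi> ((1/2) *\<^sub>R (x + y))" for x y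
    unfolding \<phi>_def dist_norm f.scaleR f.add
    by (simp add: power2_norm_eq_inner inner_simps inner_commute algebra_simps)
  have near: "(dist (X i) (X j))\<^sup>2 < 2 / Suc i + 2 / Suc j" for i j
    using par[of "X i" "X j"] X[of i] X[of j] m[of "(1/2) *\<^sub>R (X i + X j)"] by simp
  have "Cauchy X"
  proof (rule metric_CauchyI)
    fix e :: real assume "0 < e"
    then obtain N where N: "1 / Suc N < e\<^sup>2 / 4"
      using nat_approx_posE[of "e\<^sup>2 / 4"] by auto
    have "dist (X i) (X j) < e" if "N \<le> i" "N \<le> j" for i j
    proof -
      have "1 / real (Suc i) \<le> 1 / Suc N" "1 / real (Suc j) \<le> 1 / Suc N"
        using that by (simp_all add: frac_le)
      then have "(dist (X i) (X j))\<^sup>2 < e\<^sup>2" using near[of i j] N by simp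
      then show ?thesis using \<open>0 < e\<close> by (simp add: power_less_imp_less_base)
    qed
    then show "\<exists>N. \<forall>i\<ge>N. \<forall>j\<ge>N. dist (X i) (X j) < e" by blast
  qed
  then obtain z where z: "X \<longlonglongrightarrow> z" using Cauchy_convergent convergent_def by blast
  have "(\<lambda>n. \<phi> (X n)) \<longlonglongrightarrow> \<phi> z"
    unfolding \<phi>_def by (intro tendsto_intros f.tendsto z)
  moreover have "(\<lambda>n. m + 1 / Suc n) \<longlonglongrightarrow> m + 0"
    using LIMSEQ_Suc[OF lim_1_over_n] by (intro tendsto_add tendsto_const) simp
  ultimately have zm: "\<phi> z \<le> m"
    using X by (intro LIMSEQ_le[of "\<lambda>n. \<phi> (X n)"]) (auto intro: less_imp_le)
  have "f w = inner w z" for w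
  proof (rule ccontr)
    assume ne: "f w \<noteq> inner w z"
    define d where "d = f w - inner w z"
    define n where "n = inner w w"
    \<comment> \<open>The step \<open>d / n\<close> would decrease \<open>\<phi>\<close> most; the summand 1 keeps the denominator positive.\<close>
    define t where "t = d / (n + 1)"
    have n: "0 \<le> n" by (simp add: n_def)
    have "\<phi> z \<le> \<phi> (z + t *\<^sub>R w)" using zm m order_trans by blast
    then have "2 * (t * d) \<le> t * (t * n)"
      unfolding \<phi>_def f.scaleR f.add d_def n_def
      by (simp add: power2_norm_eq_inner inner_simps inner_commute algebra_simps)
    moreover have "d = t * (n + 1)" using n by (simp add: t_def)
    moreover have "0 \<le> t * (t * n)" using n by (simp flip: mult.assoc)
    ultimately have "t * t \<le> 0" by (simp add: algebra_simps)
    then have "t = 0" by (auto simp: mult_le_0_iff)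
    then show False using ne n by (simp add: t_def d_def)
  qed
  then show ?thesis by blast
qed

lemma cinner_add_right: "cinner x (y + z) = cinner x y + cinner x z"
  using cinner_add_left[of y z x]
    cinner_commute[of x y] cinner_commute[of x z] cinner_commute[of x "y + z"] by simp

lemma cinner_scaleC_right: "cinner x (a *\<^sub>C y) = cnj a * cinner x y"
  using cinner_scaleC_left[of a y x] cinner_commute[of x y] cinner_commute[of x "a *\<^sub>C y"]
  by simp

lemma cinner_self_eq_zero: "cinner x x = 0 \<longleftrightarrow> x = 0"
  by (simp add: cinner_self)

lemma cinner_ext:
  assumes "\<And>x. cinner x y = cinner x z"
  shows "y = z"
proof -
  have "cinner (y - z) (y - z) + cinner (y - z) z = 0 + cinner (y - z) z"
    by (simp add: assms flip: cinner_add_right)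
  then show ?thesis using cinner_self_eq_zero[of "y - z"] by simp
qed

lemma bounded_clinear_imp_bounded_linear:
  assumes "bounded_clinear T"
  shows "bounded_linear T"
proof -
  interpret T: Vector_Spaces.linear scaleC scaleC T using assms by (simp add: bounded_clinear_def)
  show ?thesis using assms
    by (intro bounded_linear.intro linearI bounded_linear_axioms.intro)
      (auto simp: bounded_clinear_def T.add T.scale scaleR_scaleC)
qed

text \<open>
  Riesz gives a vector with the right real part of \<open>cinner (T x) y\<close>; replacing \<open>x\<close> by \<open>\<i> x\<close>
  matches the imaginary parts too.
\<close>

lemma cinner_cadjoint:
  fixes T :: "'a::complex_hilbert_space \<Rightarrow> 'b::complex_inner"
  assumes "bounded_clinear T"
  shows "cinner (T x) y = cinner x (cadjoint T y)"
proof -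
  interpret T: Vector_Spaces.linear scaleC scaleC T using assms by (simp add: bounded_clinear_def)
  have "\<exists>z. \<forall>x. cinner (T x) y = cinner x z" for y
  proof -
    have "bounded_linear (\<lambda>x. inner (T x) y)"
      by (rule bounded_linear_compose[OF bounded_linear_inner_left
            bounded_clinear_imp_bounded_linear[OF assms]])
    then obtain z where z: "\<And>x. inner (T x) y = inner x z"
      using riesz_representation_real by blast
    have "cinner (T x) y = cinner x z" for x
    proof (rule complex_eqI)
      show "Re (cinner (T x) y) = Re (cinner x z)"
        using z[of x] by (simp add: inner_eq_Re_cinner)
      show "Im (cinner (T x) y) = Im (cinner x z)"
        using z[of "\<i> *\<^sub>C x"] by (simp add: inner_eq_Re_cinner T.scale cinner_scaleC_left)
    qed
    then show ?thesis by blast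
  qed
  then have "\<exists>S. \<forall>x y. cinner (T x) y = cinner x (S y)" by metis
  from someI_ex[OF this] show ?thesis unfolding cadjoint_def[symmetric] by blast
qed

lemma cinner_cadjoint':
  fixes T :: "'a::complex_hilbert_space \<Rightarrow> 'b::complex_inner"
  assumes "bounded_clinear T"
  shows "cinner (cadjoint T x) y = cinner x (T y)"
  using cinner_cadjoint[OF assms, of y x]
    cinner_commute[of "cadjoint T x" y] cinner_commute[of x "T y"] by simp

lemma bounded_clinear_cadjoint:
  fixes T :: "'a::complex_hilbert_space \<Rightarrow> 'b::complex_inner"
  assumes T: "bounded_clinear T"
  shows "bounded_clinear (cadjoint T)"
proof -
  let ?A = "cadjoint T"
  note adj = cinner_cadjoint[OF T, symmetric]
  have add: "?A (x + y) = ?A x + ?A y" for x y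
    by (rule cinner_ext) (simp add: adj cinner_add_right)
  have scale: "?A (a *\<^sub>C x) = a *\<^sub>C ?A x" for a x
    by (rule cinner_ext) (simp add: adj cinner_scaleC_right)
  have lin: "Vector_Spaces.linear scaleC scaleC ?A"
    by unfold_locales (simp_all add: add scale)
  obtain K where "0 < K" and K: "\<And>x. norm (T x) \<le> norm x * K"
    using bounded_linear.pos_bounded[OF bounded_clinear_imp_bounded_linear[OF T]] by blast
  have "norm (?A y) \<le> norm y * K" for y
  proof (cases "?A y = 0")
    case True
    then show ?thesis using \<open>0 < K\<close> by simp
  next
    case False
    have "norm (?A y) * norm (?A y) = inner (T (?A y)) y"
      by (simp add: inner_eq_Re_cinner cinner_cadjoint[OF T] cinner_self power2_eq_square)
    also have "\<dots> \<le> norm (T (?A y)) * norm y" by (rule norm_cauchy_schwarz)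
    also have "\<dots> \<le> norm (?A y) * K * norm y" using K by (intro mult_right_mono) auto
    finally have "norm (?A y) * norm (?A y) \<le> norm (?A y) * (norm y * K)"
      by (simp add: ac_simps)
    then show ?thesis using False by simp
  qed
  then show ?thesis using lin unfolding bounded_clinear_def by blast
qed

section \<open>The largest set on which two maps are mutually inverse\<close>

definition inverse_stable :: "('a \<Rightarrow> 'a) \<Rightarrow> ('a \<Rightarrow> 'a) \<Rightarrow> 'a set \<Rightarrow> bool" where
  "inverse_stable T T' S \<longleftrightarrow> (\<forall>x\<in>S. T x \<in> S \<and> T' x \<in> S \<and> T' (T x) = x \<and> T (T' x) = x)"

definition inverse_part :: "('a \<Rightarrow> 'a) \<Rightarrow> ('a \<Rightarrow> 'a) \<Rightarrow> 'a set" where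
  "inverse_part T T' = \<Union> {S. inverse_stable T T' S}"

lemma inverse_stable_inverse_part: "inverse_stable T T' (inverse_part T T')"
  unfolding inverse_stable_def inverse_part_def by blast

lemma inverse_stable_subset_inverse_part: "inverse_stable T T' S \<Longrightarrow> S \<subseteq> inverse_part T T'"
  unfolding inverse_part_def by blast

text \<open>Each closure property holds by maximality: the enlarged set is again inverse-stable.\<close>

lemma closed_csubspace_inverse_part:
  assumes T: "bounded_clinear T" and T': "bounded_clinear T'"
  shows "closed_csubspace (inverse_part T T')"
proof -
  let ?K = "inverse_part T T'"
  note K = inverse_stable_inverse_part[of T T', unfolded inverse_stable_def]
  interpret T: Vector_Spaces.linear scaleC scaleC T using T by (simp add: bounded_clinear_def)
  interpret T': Vector_Spaces.linear scaleC scaleC T' using T' by (simp add: bounded_clinear_def)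
  have "inverse_stable T T' {0}"
    by (simp add: inverse_stable_def T.zero T'.zero)
  then have zero: "0 \<in> ?K" using inverse_stable_subset_inverse_part by blast
  have "inverse_stable T T' {x + y |x y. x \<in> ?K \<and> y \<in> ?K}"
    unfolding inverse_stable_def using K by (fastforce simp: T.add T'.add)
  then have add: "x + y \<in> ?K" if "x \<in> ?K" "y \<in> ?K" for x y
    using inverse_stable_subset_inverse_part that by blast
  have "inverse_stable T T' {a *\<^sub>C x |a x. x \<in> ?K}"
    unfolding inverse_stable_def using K by (fastforce simp: T.scale T'.scale)
  then have scale: "a *\<^sub>C x \<in> ?K" if "x \<in> ?K" for a x
    using inverse_stable_subset_inverse_part that by blast
  have cont: "continuous_on A T" "continuous_on A T'" for A
    using T T' by (auto intro!: linear_continuous_on bounded_clinear_imp_bounded_linear)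
  have clT: "T ` closure ?K \<subseteq> closure ?K" "T' ` closure ?K \<subseteq> closure ?K"
    using K closure_subset[of ?K]
    by (intro image_closure_subset cont closed_closure; blast)+
  have "closed {x. T' (T x) = x}"
    by (intro closed_Collect_eq continuous_on_id continuous_on_compose2[OF cont(2) cont(1)])
      (rule subset_UNIV)
  moreover have "closed {x. T (T' x) = x}"
    by (intro closed_Collect_eq continuous_on_id continuous_on_compose2[OF cont(1) cont(2)])
      (rule subset_UNIV)
  ultimately have "closure ?K \<subseteq> {x. T' (T x) = x}" "closure ?K \<subseteq> {x. T (T' x) = x}"
    using K by (intro closure_minimal; blast)+
  with clT have "inverse_stable T T' (closure ?K)"
    unfolding inverse_stable_def by blast
  then have "closure ?K \<subseteq> ?K" by (rule inverse_stable_subset_inverse_part)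
  then have "closed ?K" by (metis closure_subset closure_closed subset_antisym closed_closure)
  then show ?thesis using zero add scale
    by (simp add: closed_csubspace_def complex_vector.subspace_def)
qed

text \<open>
  The sets \<open>C (V K)\<close>, with \<open>C\<close> commuting with \<open>T\<close> and \<open>T'\<close>, absorb the factors \<open>W\<close> and \<open>W'\<close> that
  appear when \<open>T\<close> and \<open>T'\<close> are moved past \<open>V\<close>, so their union is inverse-stable.
\<close>

lemma twisted_image_inverse_part:
  assumes TV: "\<And>x. T (V x) = W (V (T x))" and T'V: "\<And>x. T' (V x) = W' (V (T' x))"
    and WW': "\<And>x. W (W' x) = x" "\<And>x. W' (W x) = x"
    and comm: "\<And>x. W (T x) = T (W x)" "\<And>x. W (T' x) = T' (W x)"
      "\<And>x. W' (T x) = T (W' x)" "\<And>x. W' (T' x) = T' (W' x)"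
  shows "V ` inverse_part T T' \<subseteq> inverse_part T T'"
proof -
  let ?K = "inverse_part T T'"
  define S where "S = {C (V h) |C h. h \<in> ?K \<and> (\<forall>x. C (T x) = T (C x)) \<and> (\<forall>x. C (T' x) = T' (C x))}"
  note K = inverse_stable_inverse_part[of T T', unfolded inverse_stable_def]
  have "T s \<in> S \<and> T' s \<in> S \<and> T' (T s) = s \<and> T (T' s) = s" if "s \<in> S" for s
  proof -
    from that have "\<exists>C h. s = C (V h) \<and> h \<in> ?K
        \<and> (\<forall>x. C (T x) = T (C x)) \<and> (\<forall>x. C (T' x) = T' (C x))"
      by (simp only: S_def mem_Collect_eq)
    then obtain C h where sC: "s = C (V h) \<and> h \<in> ?K
        \<and> (\<forall>x. C (T x) = T (C x)) \<and> (\<forall>x. C (T' x) = T' (C x))"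
      by (elim exE) (rule that)
    then have s: "s = C (V h)" and h: "h \<in> ?K"
      and C: "\<And>x. C (T x) = T (C x)" "\<And>x. C (T' x) = T' (C x)"
      by simp_all
    have Ts: "T s = (C \<circ> W) (V (T h))" and T's: "T' s = (C \<circ> W') (V (T' h))"
      by (simp_all add: s TV T'V flip: C)
    have "T s \<in> S" unfolding S_def Ts using h K C comm
      by (intro CollectI exI[of _ "C \<circ> W"] exI[of _ "T h"]) simp
    moreover have "T' s \<in> S" unfolding S_def T's using h K C comm
      by (intro CollectI exI[of _ "C \<circ> W'"] exI[of _ "T' h"]) simp
    moreover have "T' (T s) = s"
    proof -
      have "T' (T s) = C (W (T' (V (T h))))" by (simp add: Ts C comm)
      also have "\<dots> = s" using h K by (simp add: T'V WW' s)
      finally show ?thesis .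
    qed
    moreover have "T (T' s) = s"
    proof -
      have "T (T' s) = C (W' (T (V (T' h))))" by (simp add: T's C comm)
      also have "\<dots> = s" using h K by (simp add: TV WW' s)
      finally show ?thesis .
    qed
    ultimately show ?thesis by blast
  qed
  then have "inverse_stable T T' S" unfolding inverse_stable_def by blast
  moreover have "V h \<in> S" if "h \<in> ?K" for h
    unfolding S_def using that by (intro CollectI exI[of _ "\<lambda>x. x"] exI[of _ h]) simp
  ultimately show ?thesis using inverse_stable_subset_inverse_part by blast
qed

section \<open>The unitary part as an inverse-stable set\<close>

lemma orthogonal_decomposition_corthogonal_comp:
  assumes "orthogonal_decomposition M N"
  shows "corthogonal_comp M = N" "corthogonal_comp N = M"
proof -
  have orth: "cinner x y = 0" "cinner y x = 0" if "x \<in> M" "y \<in> N" for x y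
    using assms that cinner_commute[of y x] by (auto simp: orthogonal_decomposition_def)
  have dec: "\<exists>x\<in>M. \<exists>y\<in>N. h = x + y" for h
    using assms by (simp add: orthogonal_decomposition_def)
  have "h \<in> N" if h: "h \<in> corthogonal_comp M" for h
  proof -
    obtain x y where xy: "x \<in> M" "y \<in> N" "h = x + y" using dec by blast
    have "cinner x h = 0" using h xy(1) by (simp add: corthogonal_comp_def)
    then have "x = 0" using xy orth by (simp add: cinner_add_right cinner_self_eq_zero)
    then show ?thesis using xy by simp
  qed
  then show "corthogonal_comp M = N" using orth by (auto simp: corthogonal_comp_def)
  have "h \<in> M" if h: "h \<in> corthogonal_comp N" for h
  proof -
    obtain x y where xy: "x \<in> M" "y \<in> N" "h = x + y" using dec by blast
    have "cinner y h = 0" using h xy(2) by (simp add: corthogonal_comp_def)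
    then have "y = 0" using xy orth by (simp add: cinner_add_right cinner_self_eq_zero)
    then show ?thesis using xy by simp
  qed
  then show "corthogonal_comp N = M" using orth by (auto simp: corthogonal_comp_def)
qed

lemma cadjoint_maps_corthogonal_comp:
  fixes T :: "'a::complex_hilbert_space \<Rightarrow> 'a"
  assumes T: "bounded_clinear T" and inv: "T ` M \<subseteq> M"
  shows "cadjoint T ` corthogonal_comp M \<subseteq> corthogonal_comp M"
  using inv by (auto simp: corthogonal_comp_def image_subset_iff simp flip: cinner_cadjoint[OF T])

lemma maps_corthogonal_comp:
  fixes T :: "'a::complex_hilbert_space \<Rightarrow> 'a"
  assumes T: "bounded_clinear T" and inv: "cadjoint T ` M \<subseteq> M"
  shows "T ` corthogonal_comp M \<subseteq> corthogonal_comp M"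
  using inv by (auto simp: corthogonal_comp_def image_subset_iff simp flip: cinner_cadjoint'[OF T])

lemma inverse_stable_unitary_part:
  fixes T :: "'a::complex_hilbert_space \<Rightarrow> 'a"
  assumes T: "bounded_clinear T" and dec: "orthogonal_decomposition M N"
    and M: "T ` M \<subseteq> M" and N: "T ` N \<subseteq> N" and unit: "unitary_on M T"
  shows "inverse_stable T (cadjoint T) M"
proof -
  note perp = orthogonal_decomposition_corthogonal_comp[OF dec]
  have A: "cadjoint T x \<in> M" if "x \<in> M" for x
    using cadjoint_maps_corthogonal_comp[OF T N] that by (auto simp: perp)
  have AT: "cadjoint T (T x) = x" if x: "x \<in> M" for x
  proof (rule cinner_ext)
    fix h
    obtain u v where uv: "u \<in> M" "v \<in> N" "h = u + v"
      using dec unfolding orthogonal_decomposition_def by blast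
    \<comment> \<open>Only the component of \<open>h\<close> in \<open>M\<close> contributes on either side.\<close>
    have "cinner v x = 0" "cinner v (cadjoint T (T x)) = 0"
      using uv(2) A M x perp(2) by (auto simp: corthogonal_comp_def)
    moreover have "cinner u (cadjoint T (T x)) = cinner u x"
      using unit uv(1) x by (simp add: unitary_on_def flip: cinner_cadjoint[OF T])
    ultimately show "cinner h (cadjoint T (T x)) = cinner h x"
      by (simp add: uv(3) cinner_add_left)
  qed
  have "T (cadjoint T x) = x" if "x \<in> M" for x
  proof -
    have "x \<in> T ` M" using unit that by (simp add: unitary_on_def)
    then obtain w where "w \<in> M" "x = T w" by blast
    then show ?thesis by (simp add: AT)
  qed
  then show ?thesis using M A AT by (auto simp: inverse_stable_def)
qed

text \<open>
  The summand \<open>H\<^sub>u\<close> is inverse-stable, and the part of the largest inverse-stable set inside \<open>H\<^sub>n\<close>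
  is a reducing subspace on which \<open>T\<close> is unitary, so complete non-unitarity makes it zero.
\<close>

lemma canonical_decomposition_eq_inverse_part:
  fixes T :: "'a::complex_hilbert_space \<Rightarrow> 'a"
  assumes T: "bounded_clinear T" and can: "canonical_decomposition T H\<^sub>u H\<^sub>n"
  shows "H\<^sub>u = inverse_part T (cadjoint T)"
proof -
  let ?K = "inverse_part T (cadjoint T)"
  have dec: "orthogonal_decomposition H\<^sub>u H\<^sub>n" and TH: "T ` H\<^sub>u \<subseteq> H\<^sub>u" "T ` H\<^sub>n \<subseteq> H\<^sub>n"
    and unit: "unitary_on H\<^sub>u T" and cnu: "cnu_on H\<^sub>n T"
    using can by (auto simp: canonical_decomposition_def reduces_on_def)
  note K = inverse_stable_inverse_part[of T "cadjoint T", unfolded inverse_stable_def]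
  have sub: "H\<^sub>u \<subseteq> ?K"
    using inverse_stable_unitary_part[OF T dec TH unit] inverse_stable_subset_inverse_part by blast
  have clK: "closed_csubspace ?K"
    by (rule closed_csubspace_inverse_part[OF T bounded_clinear_cadjoint[OF T]])
  have clN: "closed_csubspace H\<^sub>n" using dec by (simp add: orthogonal_decomposition_def)
  define M where "M = ?K \<inter> H\<^sub>n"
  have AN: "cadjoint T ` H\<^sub>n \<subseteq> H\<^sub>n"
    using cadjoint_maps_corthogonal_comp[OF T TH(1)]
    by (simp add: orthogonal_decomposition_corthogonal_comp[OF dec])
  have TM: "T ` M \<subseteq> M" and AM: "cadjoint T ` M \<subseteq> M"
    using K TH(2) AN by (auto simp: M_def)
  have "closed_csubspace M" using clK clN
    by (auto simp: M_def closed_csubspace_def complex_vector.subspace_inter)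
  then have "reduces_on H\<^sub>n T M"
    using maps_corthogonal_comp[OF T AM] TM TH(2) by (auto simp: reduces_on_def M_def)
  moreover have "unitary_on M T"
    unfolding unitary_on_def
  proof (intro conjI ballI)
    show "T ` M = M"
    proof
      show "M \<subseteq> T ` M"
      proof
        fix x assume "x \<in> M"
        then have "x = T (cadjoint T x)" "cadjoint T x \<in> M" using K AM by (auto simp: M_def)
        then show "x \<in> T ` M" by blast
      qed
    qed (rule TM)
    show "cinner (T x) (T y) = cinner x y" if "x \<in> M" "y \<in> M" for x y
      using K that by (simp add: M_def cinner_cadjoint[OF T])
  qed
  ultimately have M0: "M = {0}" using cnu unfolding cnu_on_def by blast
  have "?K \<subseteq> H\<^sub>u"
  proof
    fix h assume h: "h \<in> ?K"
    obtain x y where xy: "x \<in> H\<^sub>u" "y \<in> H\<^sub>n" "h = x + y"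
      using dec unfolding orthogonal_decomposition_def by blast
    have "h - x \<in> ?K" using clK h sub xy(1)
      by (auto simp: closed_csubspace_def intro: complex_vector.subspace_diff)
    then have "y \<in> M" using xy by (simp add: M_def)
    then show "h \<in> H\<^sub>u" using M0 xy by simp
  qed
  then show ?thesis using sub by blast
qed

section \<open>Twists\<close>

lemma unitary_cadjoint_inverse:
  fixes U :: "'a::complex_hilbert_space \<Rightarrow> 'a"
  assumes "unitary U"
  shows "cadjoint U (U x) = x" "U (cadjoint U x) = x"
proof -
  have U: "bounded_clinear U" using assms by (simp add: unitary_def)
  have 1: "cadjoint U (U x) = x" for x
    by (rule cinner_ext)
      (use assms in \<open>simp add: unitary_def unitary_on_def flip: cinner_cadjoint[OF U]\<close>)
  show "cadjoint U (U x) = x" by (rule 1)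
  have "x \<in> range U" using assms by (simp add: unitary_def unitary_on_def)
  then obtain w where "x = U w" by blast
  then show "U (cadjoint U x) = x" by (simp add: 1)
qed

text \<open>
  Conjugation by \<open>U\<close> turns \<open>A U = U A\<close> into \<open>U\<^sup>* A = A U\<^sup>*\<close>; the commutation rules for \<open>A\<^sup>*\<close> are the
  adjoints of these two.
\<close>

lemma unitary_commute_cadjoint:
  fixes U A :: "'a::complex_hilbert_space \<Rightarrow> 'a"
  assumes U: "unitary U" and A: "bounded_clinear A" and comm: "\<And>x. A (U x) = U (A x)"
  shows "cadjoint U (A x) = A (cadjoint U x)"
    and "U (cadjoint A x) = cadjoint A (U x)"
    and "cadjoint U (cadjoint A x) = cadjoint A (cadjoint U x)"
proof -
  note inv = unitary_cadjoint_inverse[OF U]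
  have bU: "bounded_clinear U" using U by (simp add: unitary_def)
  note swap = cinner_cadjoint[OF A, symmetric] cinner_cadjoint[OF bU, symmetric]
    cinner_cadjoint'[OF bU, symmetric]
  have 1: "cadjoint U (A x) = A (cadjoint U x)" for x
    by (metis comm inv)
  then show "cadjoint U (A x) = A (cadjoint U x)" .
  show "U (cadjoint A x) = cadjoint A (U x)"
    by (rule cinner_ext) (simp add: swap 1)
  show "cadjoint U (cadjoint A x) = cadjoint A (cadjoint U x)"
    by (rule cinner_ext) (simp add: swap comm)
qed

text \<open>
  Taking adjoints in both relations shows that \<open>(T, V\<^sup>*)\<close> is twisted by \<open>U\<^sup>*\<close>: the adjoint of the
  second relation yields the first one for \<open>V\<^sup>*\<close>, and conversely.
\<close>

lemma twist_cadjoint: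
  fixes T V U :: "'a::complex_hilbert_space \<Rightarrow> 'a"
  assumes T: "bounded_clinear T" and V: "bounded_clinear V" and tw: "is_twist U T V"
  shows "T (cadjoint V x) = cadjoint U (cadjoint V (T x))"
    and "cadjoint T (cadjoint V x) = U (cadjoint V (cadjoint T x))"
proof -
  have U: "unitary U" and TV: "\<And>x. T (V x) = U (V (T x))"
    and AV: "\<And>x. cadjoint T (V x) = cadjoint U (V (cadjoint T x))"
    and TU: "\<And>x. T (U x) = U (T x)" and VU: "\<And>x. V (U x) = U (V x)"
    using tw unfolding is_twist_def by (auto simp: fun_eq_iff)
  have bU: "bounded_clinear U" using U by (simp add: unitary_def)
  note inv = unitary_cadjoint_inverse[OF U]
  note cT = unitary_commute_cadjoint[OF U T TU] and cV = unitary_commute_cadjoint[OF U V VU]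
  have VA: "V (cadjoint T x) = U (cadjoint T (V x))" for x by (simp add: AV inv)
  have VT: "V (T x) = cadjoint U (T (V x))" for x by (simp add: TV inv)
  have "T (cadjoint V x) = cadjoint V (T (cadjoint U x))"
    by (rule cinner_ext)
      (simp add: VA cinner_cadjoint[OF V, symmetric] cinner_cadjoint'[OF T, symmetric]
        cinner_cadjoint[OF bU, symmetric])
  then show "T (cadjoint V x) = cadjoint U (cadjoint V (T x))" by (simp add: cT cV)
  have "cadjoint T (cadjoint V x) = cadjoint V (cadjoint T (U x))"
    by (rule cinner_ext)
      (simp add: VT cinner_cadjoint[OF V, symmetric] cinner_cadjoint[OF T, symmetric]
        cinner_cadjoint'[OF bU, symmetric])
  then show "cadjoint T (cadjoint V x) = U (cadjoint V (cadjoint T x))" by (simp add: cT cV)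
qed

theorem theorem3p1:
  fixes T V :: "'a::complex_hilbert_space \<Rightarrow> 'a"
    and H\<^sub>u H\<^sub>n :: "'a set"
  assumes "separable_space (euclidean :: 'a topology)"
    and "doubly_twisted T V"
    and "contraction T"
    and "canonical_decomposition T H\<^sub>u H\<^sub>n"
  shows "reduces V H\<^sub>u \<and> reduces V H\<^sub>n"
proof -
  obtain U where T: "bounded_clinear T" and V: "bounded_clinear V" and tw: "is_twist U T V"
    using assms(2) by (auto simp: doubly_twisted_def)
  have U: "unitary U" and TV: "\<And>x. T (V x) = U (V (T x))"
    and AV: "\<And>x. cadjoint T (V x) = cadjoint U (V (cadjoint T x))"
    and TU: "\<And>x. T (U x) = U (T x)"
    using tw unfolding is_twist_def by (auto simp: fun_eq_iff)
  note inv = unitary_cadjoint_inverse[OF U] and comm = unitary_commute_cadjoint[OF U T TU]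
  note Hu = canonical_decomposition_eq_inverse_part[OF T assms(4)]
  have dec: "orthogonal_decomposition H\<^sub>u H\<^sub>n"
    using assms(4) by (simp add: canonical_decomposition_def)
  note perp = orthogonal_decomposition_corthogonal_comp[OF dec]
  have VHu: "V ` H\<^sub>u \<subseteq> H\<^sub>u"
    unfolding Hu
    by (rule twisted_image_inverse_part[where W = U and W' = "cadjoint U"])
      (simp_all add: TV AV inv comm TU)
  have "cadjoint V ` H\<^sub>u \<subseteq> H\<^sub>u"
    unfolding Hu
    by (rule twisted_image_inverse_part[where W = "cadjoint U" and W' = U])
      (simp_all add: twist_cadjoint[OF T V tw] inv comm TU)
  then have "V ` H\<^sub>n \<subseteq> H\<^sub>n" using maps_corthogonal_comp[OF V] perp by metis
  then show ?thesis using VHu dec perp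
    by (simp add: reduces_on_def orthogonal_decomposition_def)
qed

end
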